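(* For all integers $n\geq 0$, \begin{align*} a_{37}(43n+12)&\equiv 0 \pmod{43}, & a_{41}(47n+21)&\equiv 0 \pmod{47}, \\ a_{53}(59n+56)&\equiv 0 \pmod{59}, & a_{61}(67n+19)&\equiv 0 \pmod{67},\\ a_{65}(71n+32)&\equiv 0 \pmod{71}, & a_{73}(79n+62)&\equiv 0 \pmod{79},\\ a_{77}(83n+79)&\equiv 0 \pmod{83}. & & \end{align*}
   Context: For an integer $k\geq 1$ let $f_k:=\prod_{n\geq 1}(1-q^{kn})$. For an integer $c\geq 1$, the generalized cubic partition function $a_c(n)$ is defined by the generating function $\sum_{n\geq 0}a_c(n)q^n=\dfrac{1}{f_1f_2^{c-1}}$ (so $a_c(0)=1$). *)

theory Defs
  imports "HOL-Computational_Algebra.Formal_Power_Series"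
begin

text \<open>The infinite product f_k = prod_{n>=1} (1 - q^(k n)) as a formal power series (over the
  rationals, so that it can be inverted). Its n-th coefficient is the n-th coefficient of the
  finite partial product up to index n (all further factors are congruent to 1 modulo q^(n+1));
  this is the X-adic limit of the partial products.\<close>
definition eta_prod :: "nat \<Rightarrow> rat fps" where
  "eta_prod k = Abs_fps (\<lambda>n. fps_nth (\<Prod>m\<in>{1..n}. (1 - fps_X ^ (k * m))) n)"

text \<open>Generalized cubic partition function: sum a_c(n) q^n = 1 / (f_1 f_2^(c-1)).
  (The values are integers since the constant term of the denominator is 1.)\<close>
definition a_gen :: "nat \<Rightarrow> nat \<Rightarrow> rat" where
  "a_gen c n = fps_nth (inverse (eta_prod 1 * eta_prod 2 ^ (c - 1))) n"

definition zero_mod :: "rat \<Rightarrow> int \<Rightarrow> bool" where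
  "zero_mod x m \<longleftrightarrow> (\<exists>k::int. x = of_int (m * k))"

end

theory Submission
  imports Defs "HOL-Number_Theory.Euler_Criterion"
begin

text \<open>
  Let \<open>p = c + 6\<close>, a prime with \<open>p \<equiv> 3 (mod 4)\<close>. As \<open>f\<^sub>2\<^sup>p \<equiv> f\<^sub>2\<^sub>p (mod p)\<close>,
  the generating function \<open>1 / (f\<^sub>1 f\<^sub>2\<^bsup>p-7\<^esup>)\<close> is congruent to \<open>F / f\<^sub>2\<^sub>p\<close> with
  \<open>F = f\<^sub>2\<^sup>7 / f\<^sub>1\<close>, and it suffices that \<open>p\<close> divides the \<open>n\<close>-th coefficient of \<open>F\<close>
  whenever \<open>p\<close> divides \<open>24n + 13\<close>. With \<open>D = q d/dq\<close> one has the Wronskian identity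
  \<open>f\<^sub>1(q) Df\<^sub>1(-q) - f\<^sub>1(-q) Df\<^sub>1(q) = 2q F(q\<^sup>2)\<close>.
  By Euler's pentagonal number theorem the coefficients of the left-hand side are signed sums of
  \<open>(y\<^sup>2 - x\<^sup>2) / 24\<close> over \<open>x\<^sup>2 + y\<^sup>2 = 2 (24n + 13)\<close>, and \<open>p | x\<^sup>2 + y\<^sup>2\<close> forces \<open>p | x\<close>
  and \<open>p | y\<close>.

  The Wronskian identity follows from \<open>\<phi>(-q) = f\<^sub>1\<^sup>2 / f\<^sub>2\<close>, since the Wronskian of \<open>\<phi>(-q)\<close> and
  \<open>\<phi>(q)\<close> is \<open>4q f\<^sub>4\<^sup>6\<close> by Jacobi's series for \<open>f\<^sub>4\<^sup>3\<close> and a rotation of the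
  summation lattice. The three theta series are limits of a finite form of the triple product.
\<close>

section \<open>Formal power series\<close>

instance fps :: (group_add) topological_group_add
proof
  fix f g :: "'a fps"
  show "LIM h (nhds f \<times>\<^sub>F nhds g). fst h + snd h :> nhds (f + g)"
  proof (rule tendsto_fpsI)
    show "\<forall>\<^sub>F h in nhds f \<times>\<^sub>F nhds g. fps_nth (fst h + snd h) n = fps_nth (f + g) n" for n
      using eventually_prodI[OF eventually_fps_nth_eq_nhds_fps[of n f] eventually_fps_nth_eq_nhds_fps[of n g]]
      by eventually_elim simp
  qed
  show "(uminus \<longlongrightarrow> - f) (nhds f)"
    by (rule tendsto_fpsI, rule eventually_mono[OF eventually_fps_nth_eq_nhds_fps]) simp
qed

instance fps :: (ring_1) topological_monoid_mult
proof
  fix f g :: "'a fps"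
  show "LIM h (nhds f \<times>\<^sub>F nhds g). fst h * snd h :> nhds (f * g)"
  proof (rule tendsto_fpsI)
    show "\<forall>\<^sub>F h in nhds f \<times>\<^sub>F nhds g. fps_nth (fst h * snd h) n = fps_nth (f * g) n" for n
      using eventually_prodI[OF eventually_fps_nth_eq_nhds_fps_strong[of n f]
          eventually_fps_nth_eq_nhds_fps_strong[of n g]]
      by eventually_elim (simp add: fps_mult_nth)
  qed
qed

lemma tendsto_fps_compose [tendsto_intros]:
  fixes A B :: "'a::comm_ring_1 fps"
  assumes "(f \<longlongrightarrow> A) F"
  shows "((\<lambda>x. f x oo B) \<longlongrightarrow> A oo B) F"
proof (rule tendsto_fpsI)
  fix n
  have "\<forall>\<^sub>F x in F. \<forall>k\<in>{0..n}. fps_nth (f x) k = fps_nth A k"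
    using assms by (auto simp: tendsto_fps_iff intro: eventually_ball_finite)
  then show "\<forall>\<^sub>F x in F. fps_nth (f x oo B) n = fps_nth (A oo B) n"
    by eventually_elim (simp add: fps_compose_nth)
qed

lemma fps_compose_X_power_nth:
  fixes A :: "'a::idom fps"
  assumes "d > 0"
  shows "fps_nth (A oo fps_X ^ d) n = (if d dvd n then fps_nth A (n div d) else 0)"
proof -
  have "fps_nth (A oo fps_X ^ d) n = (\<Sum>i\<in>{0..n}. if n = d * i then fps_nth A i else 0)"
    unfolding fps_compose_nth by (intro sum.cong refl) (simp add: power_mult[symmetric])
  also have "\<dots> = (\<Sum>i\<in>{i \<in> {0..n}. n = d * i}. fps_nth A i)"
    by (rule sum.inter_filter[symmetric]) simp
  also have "{i \<in> {0..n}. n = d * i} = (if d dvd n then {n div d} else {})"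
    using assms by auto
  finally show ?thesis by simp
qed

lemma fps_XD_mult: "fps_XD (a * b) = fps_XD a * b + a * fps_XD b" for a b :: "'a::comm_ring_1 fps"
  by (simp add: fps_XD_def algebra_simps)

section \<open>Gaussian binomials and the finite Jacobi triple product\<close>

definition qfac :: "'a::comm_ring_1 \<Rightarrow> nat \<Rightarrow> 'a" where
  "qfac q n = (\<Prod>m\<in>{1..n}. 1 - q ^ m)"

lemma qfac_0 [simp]: "qfac q 0 = 1"
  by (simp add: qfac_def)

lemma qfac_Suc [simp]: "qfac q (Suc n) = qfac q n * (1 - q ^ Suc n)"
  by (simp add: qfac_def)

lemma prod_one_minus_eq_qfac: "(\<Prod>i<n. 1 - q * q ^ i) = qfac q n"
  by (induction n) simp_all

lemma qfac_double: "qfac q (2 * n) = qfac (q ^ 2) n * (\<Prod>i<n. 1 - q * (q ^ 2) ^ i)"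
proof (induction n)
  case (Suc n)
  have index: "2 * Suc n = Suc (Suc (2 * n))" by simp
  have "q ^ Suc (2 * n) = q * (q ^ 2) ^ n" "q ^ Suc (Suc (2 * n)) = (q ^ 2) ^ Suc n"
    by (simp_all add: power_mult power2_eq_square mult.assoc)
  then show ?case unfolding index qfac_Suc Suc prod.lessThan_Suc by (simp only: mult_ac)
qed simp

lemma qfac_triple:
  "qfac q (3 * n) = qfac (q ^ 3) n * ((\<Prod>i<n. 1 - q * (q ^ 3) ^ i) * (\<Prod>i<n. 1 - q ^ 2 * (q ^ 3) ^ i))"
proof (induction n)
  case (Suc n)
  have index: "3 * Suc n = Suc (Suc (Suc (3 * n)))" by simp
  have "q ^ Suc (3 * n) = q * (q ^ 3) ^ n" "q ^ Suc (Suc (3 * n)) = q ^ 2 * (q ^ 3) ^ n"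
    "q ^ Suc (Suc (Suc (3 * n))) = (q ^ 3) ^ Suc n"
    by (simp_all add: power_mult power2_eq_square power3_eq_cube mult.assoc)
  then show ?case unfolding index qfac_Suc Suc prod.lessThan_Suc by (simp only: mult_ac)
qed simp

lemma qfac_mult_qfac_neg:
  "qfac q (2 * n) * qfac (- q) (2 * n) * qfac (q ^ 4) n = qfac (q ^ 2) n ^ 2 * qfac (q ^ 2) (2 * n)"
proof -
  let ?odd = "\<lambda>q. \<Prod>i<n. 1 - q * (q ^ 2) ^ i"
  have "?odd q * ?odd (- q) = ?odd (q ^ 2)"
    unfolding prod.distrib[symmetric]
    by (intro prod.cong refl) (simp add: algebra_simps power2_eq_square power_mult_distrib)
  moreover have "qfac (q ^ 2) (2 * n) = qfac (q ^ 4) n * ?odd (q ^ 2)"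
    using qfac_double[of "q ^ 2" n] by simp
  ultimately have "qfac (q ^ 2) (2 * n) = qfac (q ^ 4) n * (?odd q * ?odd (- q))"
    by (simp only:)
  then show ?thesis
    unfolding qfac_double[of q] qfac_double[of "- q"] power2_minus by (simp only: power2_eq_square mult_ac)
qed

fun qbin :: "'a::comm_ring_1 \<Rightarrow> nat \<Rightarrow> nat \<Rightarrow> 'a" where
  "qbin q n 0 = 1"
| "qbin q 0 (Suc k) = 0"
| "qbin q (Suc n) (Suc k) = qbin q n k + q ^ Suc k * qbin q n (Suc k)"

lemma qbin_eq_0: "n < k \<Longrightarrow> qbin q n k = 0"
  by (induction q n k rule: qbin.induct) auto

lemma qbin_self: "qbin q n n = 1"
  by (induction n) (simp_all add: qbin_eq_0)

lemma qbin_mult_qfac: "qbin q (m + n) m * (qfac q m * qfac q n) = qfac q (m + n)"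
proof (induction m arbitrary: n)
  case (Suc m)
  note IH_m = Suc.IH
  show ?case
  proof (induction n)
    case 0
    then show ?case by (simp add: qbin_self)
  next
    case (Suc n)
    have "qbin q (Suc m + Suc n) (Suc m) * (qfac q (Suc m) * qfac q (Suc n))
        = (1 - q ^ Suc m) * (qbin q (m + Suc n) m * (qfac q m * qfac q (Suc n)))
        + q ^ Suc m * (1 - q ^ Suc n) * (qbin q (Suc m + n) (Suc m) * (qfac q (Suc m) * qfac q n))"
      by (simp add: algebra_simps)
    also have "\<dots> = ((1 - q ^ Suc m) + q ^ Suc m * (1 - q ^ Suc n)) * qfac q (Suc m + n)"
      unfolding Suc.IH IH_m by (simp add: algebra_simps)
    also have "\<dots> = qfac q (Suc m + Suc n)"
      by (simp add: algebra_simps power_add)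
    finally show ?case .
  qed
qed simp

lemma q_binomial_theorem:
  "(\<Prod>i<n. 1 + b * q ^ i) = (\<Sum>k\<le>n. qbin q n k * q ^ (k choose 2) * b ^ k)"
proof (induction n arbitrary: b)
  case (Suc n)
  let ?s = "\<lambda>k. q ^ (k choose 2)"
  have s_Suc: "?s (Suc k) = ?s k * q ^ k" for k
    by (simp add: numeral_2_eq_2 power_add)
  have "(\<Prod>i<Suc n. 1 + b * q ^ i) = (1 + b) * (\<Prod>i<n. 1 + (b * q) * q ^ i)"
    by (subst prod.lessThan_Suc_shift) (simp add: mult_ac)
  also have "\<dots> = (1 + b) * (\<Sum>k\<le>n. qbin q n k * ?s k * (b * q) ^ k)"
    by (simp only: Suc)
  also have "\<dots> = (\<Sum>k\<le>Suc n. qbin q n k * ?s k * (b * q) ^ k)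
      + b * (\<Sum>k\<le>n. qbin q n k * ?s k * (b * q) ^ k)"
    by (simp add: algebra_simps qbin_eq_0)
  also have "\<dots> = 1 + ((\<Sum>k\<le>n. qbin q n (Suc k) * ?s (Suc k) * (b * q) ^ Suc k)
      + (\<Sum>k\<le>n. qbin q n k * ?s (Suc k) * b ^ Suc k))"
    by (subst sum.atMost_Suc_shift)
      (simp add: s_Suc power_mult_distrib sum_distrib_left mult_ac, simp add: numeral_2_eq_2)
  also have "\<dots> = 1 + (\<Sum>k\<le>n. qbin q (Suc n) (Suc k) * ?s (Suc k) * b ^ Suc k)"
    by (simp add: sum.distrib[symmetric] algebra_simps power_mult_distrib)
  also have "\<dots> = (\<Sum>k\<le>Suc n. qbin q (Suc n) k * ?s k * b ^ k)"
    by (subst sum.atMost_Suc_shift) (simp add: numeral_2_eq_2)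
  finally show ?case .
qed (simp add: numeral_2_eq_2)

definition triangle :: "int \<Rightarrow> nat" where
  "triangle j = nat (j * (j + 1) div 2)"

lemma two_times_triangle: "2 * int (triangle j) = j * (j + 1)"
proof -
  have "0 \<le> j * (j + 1)" by (cases "j \<ge> 0") (auto intro!: mult_nonpos_nonpos)
  then show ?thesis by (simp add: triangle_def)
qed

lemma triangle_eqI: "2 * int n = j * (j + 1) \<Longrightarrow> triangle j = n"
  using two_times_triangle[of j] by simp

lemma triangle_add_1: "int (triangle (j + 1)) = int (triangle j) + j + 1"
  using two_times_triangle[of j] two_times_triangle[of "j + 1"] by (simp add: algebra_simps)

lemma abs_le_triangle: "\<bar>j\<bar> \<le> int (triangle j) + 1"
proof -
  have "0 \<le> (\<bar>j\<bar> - 1) * (\<bar>j\<bar> - 2)" by (auto simp: zero_le_mult_iff)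
  then have "3 * \<bar>j\<bar> \<le> j * j + 2" by (simp add: algebra_simps)
  then show ?thesis using two_times_triangle[of j] by (simp add: algebra_simps)
qed

lemma int_triangle_plus_triangle: "int (triangle j + triangle (j - 1)) = j ^ 2"
  using two_times_triangle[of j] two_times_triangle[of "j - 1"]
  by (simp add: algebra_simps power2_eq_square)

definition theta_term :: "'a::comm_ring_1 \<Rightarrow> 'a \<Rightarrow> int \<Rightarrow> 'a" where
  "theta_term a b j = a ^ triangle j * b ^ triangle (j - 1)"

lemma theta_term_shift:
  "(a * b) ^ k * theta_term a b (int m - int k + 1) = a * (a * b) ^ m * theta_term a b (int m - int k)"
proof -
  let ?j = "int m - int k"
  have exponent_a: "k + triangle (?j + 1) = Suc (m + triangle ?j)"
    using triangle_add_1[of ?j] by linarith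
  have exponent_b: "k + triangle ?j = m + triangle (?j - 1)"
    using triangle_add_1[of "?j - 1"] by simp
  have "(a * b) ^ k * theta_term a b (?j + 1) = a ^ (k + triangle (?j + 1)) * b ^ (k + triangle ?j)"
    by (simp add: theta_term_def power_mult_distrib power_add mult_ac)
  also have "\<dots> = a * (a * b) ^ m * theta_term a b ?j"
    unfolding exponent_a exponent_b by (simp add: theta_term_def power_mult_distrib power_add mult_ac)
  finally show ?thesis .
qed

lemma theta_term_minus_nat: "theta_term a b (- int k) = (a * b) ^ (k choose 2) * b ^ k"
proof -
  have "even (k * (k - 1))" by (cases k) auto
  then have choose: "2 * (k choose 2) = k * (k - 1)" unfolding choose_two by simp
  have "triangle (- int k) = k choose 2"
  proof (rule triangle_eqI)
    have "2 * int (k choose 2) = int (k * (k - 1))" unfolding choose[symmetric] by simp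
    then show "2 * int (k choose 2) = - int k * (- int k + 1)" by (cases k) (auto simp: algebra_simps)
  qed
  moreover from this have "triangle (- int k - 1) = (k choose 2) + k"
    using triangle_add_1[of "- int k - 1"] by simp
  ultimately show ?thesis
    by (simp add: theta_term_def power_add power_mult_distrib mult_ac)
qed

definition jtp_sum :: "'a::comm_ring_1 \<Rightarrow> 'a \<Rightarrow> (int \<Rightarrow> 'a) \<Rightarrow> nat \<Rightarrow> nat \<Rightarrow> 'a" where
  "jtp_sum a b w m n =
     (\<Sum>j = - int n..int m. w j * qbin (a * b) (m + n) (nat (int m - j)) * theta_term a b j)"

lemma jtp_sum_atMost:
  "jtp_sum a b w m n =
     (\<Sum>k\<le>m + n. w (int m - int k) * qbin (a * b) (m + n) k * theta_term a b (int m - int k))"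
  unfolding jtp_sum_def
  by (rule sum.reindex_bij_witness[where i = "\<lambda>k. int m - int k" and j = "\<lambda>j. nat (int m - j)"]) auto

lemma jtp_sum_Suc:
  "jtp_sum a b w (Suc m) n = jtp_sum a b w m n + a * (a * b) ^ m * jtp_sum a b (\<lambda>j. w (j + 1)) m n"
proof -
  let ?q = "a * b" and ?T = "theta_term a b"
  let ?shifted = "\<lambda>k. w (int m - int k + 1) * (?q ^ k * qbin ?q (m + n) k) * ?T (int m - int k + 1)"
  have "jtp_sum a b w (Suc m) n
      = ?shifted 0 + (\<Sum>k\<le>m + n. w (int m - int k) * qbin ?q (Suc (m + n)) (Suc k) * ?T (int m - int k))"
    unfolding jtp_sum_atMost add_Suc sum.atMost_Suc_shift by (simp add: algebra_simps)
  also have "\<dots> = jtp_sum a b w m n + (?shifted 0 + (\<Sum>k\<le>m + n. ?shifted (Suc k)))"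
    by (simp add: jtp_sum_atMost distrib_left distrib_right sum.distrib)
  also have "?shifted 0 + (\<Sum>k\<le>m + n. ?shifted (Suc k)) = (\<Sum>k\<le>m + n. ?shifted k)"
    using sum.atMost_Suc_shift[of ?shifted "m + n"] by (simp add: qbin_eq_0)
  also have "\<dots> = (\<Sum>k\<le>m + n. w (int m - int k + 1) * qbin ?q (m + n) k
      * (?q ^ k * ?T (int m - int k + 1)))"
    by (simp only: mult_ac)
  also have "\<dots> = a * ?q ^ m * jtp_sum a b (\<lambda>j. w (j + 1)) m n"
    unfolding theta_term_shift jtp_sum_atMost sum_distrib_left by (simp only: mult_ac)
  finally show ?thesis .
qed

theorem finite_jacobi_triple_product:
  "jtp_sum a b (\<lambda>_. 1) m n = (\<Prod>i<m. 1 + a * (a * b) ^ i) * (\<Prod>i<n. 1 + b * (a * b) ^ i)"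
proof (induction m)
  case 0
  show ?case
    by (simp add: jtp_sum_atMost theta_term_minus_nat q_binomial_theorem mult.assoc)
next
  case (Suc m)
  then show ?case by (simp add: jtp_sum_Suc algebra_simps)
qed

text \<open>At \<open>a = -1\<close> the triple product vanishes; the weight \<open>1 - 2j\<close> extracts its derivative there.\<close>
lemma finite_jacobi_cube:
  "jtp_sum (- 1) (- q) (\<lambda>j. of_int (1 - 2 * j)) (Suc m) n = 2 * (qfac q m * qfac q n)"
proof -
  let ?J = "jtp_sum (- 1) (- q)" and ?w = "\<lambda>j. of_int (1 - 2 * j)"
  have shift: "?J (\<lambda>j. ?w (j + 1)) m n = ?J ?w m n - 2 * ?J (\<lambda>_. 1) m n" for m
    unfolding jtp_sum_def sum_distrib_left sum_subtractf[symmetric]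
    by (intro sum.cong refl) (simp add: algebra_simps)
  have step: "?J ?w (Suc m) n = (1 - q ^ m) * ?J ?w m n + 2 * q ^ m * ?J (\<lambda>_. 1) m n" for m
    using jtp_sum_Suc[of "- 1" "- q" ?w m n] unfolding shift by (simp add: algebra_simps)
  show ?thesis
  proof (induction m)
    case 0
    then show ?case
      unfolding step finite_jacobi_triple_product by (simp add: prod_one_minus_eq_qfac)
  next
    case (Suc m)
    have vanishing: "?J (\<lambda>_. 1) (Suc m) n = 0"
      unfolding finite_jacobi_triple_product by (subst prod.lessThan_Suc_shift) simp
    show ?case unfolding step[of "Suc m"] Suc vanishing by (simp add: mult_ac)
  qed
qed

section \<open>Infinite products and theta series\<close>

lemma qfac_X_power_nth:
  assumes "d > 0" "n \<le> k"
  shows "fps_nth (qfac (fps_X ^ d) k) n = fps_nth (eta_prod d) n"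
  using assms(2)
proof (induction k rule: dec_induct)
  case base
  show ?case by (simp add: eta_prod_def qfac_def power_mult)
next
  case (step k)
  have "Suc k \<le> d * Suc k" using assms(1) by (cases d) simp_all
  then have "n < d * Suc k" using step(1) by linarith
  then show ?case
    using step
    by (simp add: right_diff_distrib power_mult[symmetric] fps_X_power_mult_right_nth
        del: power_Suc mult_Suc_right)
qed

lemma qfac_tendsto_eta_prod:
  assumes "d > 0" "filterlim k at_top F"
  shows "((\<lambda>x. qfac (fps_X ^ d) (k x)) \<longlongrightarrow> eta_prod d) F"
proof (rule tendsto_fpsI)
  fix n
  have "\<forall>\<^sub>F x in F. n \<le> k x" using assms(2) by (simp add: filterlim_at_top)
  then show "\<forall>\<^sub>F x in F. fps_nth (qfac (fps_X ^ d) (k x)) n = fps_nth (eta_prod d) n"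
    by eventually_elim (rule qfac_X_power_nth[OF assms(1)])
qed

lemma eta_prod_nth_0 [simp]: "fps_nth (eta_prod d) 0 = 1"
  by (simp add: eta_prod_def)

lemma eta_prod_neq_0 [simp]: "eta_prod d \<noteq> 0"
  using eta_prod_nth_0[of d] by force

lemma eta_prod_mult_inverse [simp]: "eta_prod d * inverse (eta_prod d) = 1"
  by (rule inverse_mult_eq_1') simp

lemma qfac_compose:
  fixes A B :: "'a::idom fps"
  assumes "fps_nth B 0 = 0"
  shows "qfac A n oo B = qfac (A oo B) n"
  using assms by (simp add: qfac_def fps_compose_prod_distrib fps_compose_sub_distrib fps_compose_power)

lemma qfac_tendsto_eta_prod_compose:
  assumes "d > 0" "filterlim k at_top F" "fps_nth B 0 = 0"
  shows "((\<lambda>x. qfac (B ^ d) (k x)) \<longlongrightarrow> eta_prod d oo B) F"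
  using tendsto_fps_compose[OF qfac_tendsto_eta_prod[OF assms(1,2)], of B] assms(3)
  by (simp add: qfac_compose fps_X_power_compose)

lemma eta_prod_compose_X_power:
  assumes "k > 0" "d > 0"
  shows "eta_prod k oo fps_X ^ d = eta_prod (d * k)"
proof (rule LIMSEQ_unique)
  show "(\<lambda>n. qfac (fps_X ^ (d * k)) n) \<longlonglongrightarrow> (eta_prod k oo fps_X ^ d)"
    using qfac_tendsto_eta_prod_compose[of k "\<lambda>n. n" sequentially "fps_X ^ d"] assms
    by (simp add: filterlim_ident power_mult)
  show "(\<lambda>n. qfac (fps_X ^ (d * k)) n) \<longlonglongrightarrow> eta_prod (d * k)"
    using assms by (intro qfac_tendsto_eta_prod filterlim_ident) simp
qed

lemma eta_prod_compose_neg_X: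
  assumes "d > 0" "even d"
  shows "eta_prod d oo - fps_X = eta_prod d"
proof (rule LIMSEQ_unique)
  show "(\<lambda>n. qfac (fps_X ^ d) n) \<longlonglongrightarrow> (eta_prod d oo - fps_X)"
    using qfac_tendsto_eta_prod_compose[of d "\<lambda>n. n" sequentially "- fps_X"] assms
    by (simp add: filterlim_ident)
  show "(\<lambda>n. qfac (fps_X ^ d) n) \<longlonglongrightarrow> eta_prod d"
    using assms by (intro qfac_tendsto_eta_prod filterlim_ident)
qed

lemma filterlim_nat_int_add:
  assumes "filterlim m at_top F"
  shows "filterlim (\<lambda>x. nat (int (m x) + j)) at_top F"
  unfolding filterlim_at_top
proof
  fix k
  have "\<forall>\<^sub>F x in F. k + nat \<bar>j\<bar> \<le> m x" using assms by (simp add: filterlim_at_top)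
  then show "\<forall>\<^sub>F x in F. k \<le> nat (int (m x) + j)" by eventually_elim linarith
qed

lemma eta_prod_mult_eta_prod_neg:
  "eta_prod 1 * (eta_prod 1 oo - fps_X) * eta_prod 4 = eta_prod 2 ^ 3"
proof (rule LIMSEQ_unique)
  let ?qfac = "\<lambda>d. qfac (fps_X ^ d) :: nat \<Rightarrow> rat fps"
  show "(\<lambda>n. ?qfac 1 (2 * n) * qfac ((- fps_X) ^ 1) (2 * n) * ?qfac 4 n)
      \<longlonglongrightarrow> eta_prod 1 * (eta_prod 1 oo - fps_X) * eta_prod 4"
    by (intro tendsto_mult qfac_tendsto_eta_prod qfac_tendsto_eta_prod_compose
        mult_nat_left_at_top filterlim_ident) auto
  have "?qfac 1 (2 * n) * qfac ((- fps_X) ^ 1) (2 * n) * ?qfac 4 n = ?qfac 2 n ^ 2 * ?qfac 2 (2 * n)" for n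
    unfolding power_one_right by (rule qfac_mult_qfac_neg)
  moreover have "(\<lambda>n. ?qfac 2 n ^ 2 * ?qfac 2 (2 * n)) \<longlonglongrightarrow> eta_prod 2 ^ 2 * eta_prod 2"
    by (intro tendsto_intros qfac_tendsto_eta_prod mult_nat_left_at_top filterlim_ident) auto
  ultimately show "(\<lambda>n. ?qfac 1 (2 * n) * qfac ((- fps_X) ^ 1) (2 * n) * ?qfac 4 n) \<longlonglongrightarrow> eta_prod 2 ^ 3"
    by (simp only: power3_eq_cube power2_eq_square)
qed

lemma qbin_tendsto_inverse_eta_prod:
  assumes "d > 0" "filterlim m at_top F" "filterlim n at_top F"
  shows "((\<lambda>x. qbin (fps_X ^ d) (m x + n x) (m x)) \<longlongrightarrow> inverse (eta_prod d)) F"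
proof -
  let ?qfac = "qfac (fps_X ^ d) :: nat \<Rightarrow> rat fps"
  have unit: "?qfac k * inverse (?qfac k) = 1" for k
    using qfac_X_power_nth[of d 0 k] assms(1) by (intro inverse_mult_eq_1') simp
  have "qbin (fps_X ^ d) (m x + n x) (m x) * ((?qfac (m x) * inverse (?qfac (m x)))
      * (?qfac (n x) * inverse (?qfac (n x))))
      = ?qfac (m x + n x) * (inverse (?qfac (m x)) * inverse (?qfac (n x)))" for x
    unfolding qbin_mult_qfac[symmetric] by (simp only: mult_ac)
  then have "qbin (fps_X ^ d) (m x + n x) (m x)
      = ?qfac (m x + n x) * (inverse (?qfac (m x)) * inverse (?qfac (n x)))" for x
    by (simp add: unit)
  moreover have "((\<lambda>x. ?qfac (m x + n x) * (inverse (?qfac (m x)) * inverse (?qfac (n x))))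
      \<longlongrightarrow> eta_prod d * (inverse (eta_prod d) * inverse (eta_prod d))) F"
    using assms
    by (intro tendsto_intros qfac_tendsto_eta_prod filterlim_at_top_mono[OF assms(2), of "\<lambda>x. m x + n x"])
      simp_all
  ultimately show ?thesis by (simp add: mult.assoc[symmetric])
qed

definition proper_exponent :: "('b \<Rightarrow> nat) \<Rightarrow> bool" where
  "proper_exponent e \<longleftrightarrow> (\<forall>n. finite {j. e j \<le> n})"

text \<open>The series \<open>\<Sum>\<^sub>j w\<^sub>j q\<^bsup>e j\<^esup>\<close>; if \<open>e\<close> is not proper, the coefficients over its infinite
  fibres are \<open>0\<close>.\<close>
definition theta_series :: "('b \<Rightarrow> nat) \<Rightarrow> ('b \<Rightarrow> 'a) \<Rightarrow> 'a::comm_ring_1 fps" where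
  "theta_series e w = Abs_fps (\<lambda>n. \<Sum>j | e j = n. w j)"

lemma theta_series_nth: "fps_nth (theta_series e w) n = (\<Sum>j | e j = n. w j)"
  by (simp add: theta_series_def)

lemma proper_exponent_finite_fibre: "proper_exponent e \<Longrightarrow> finite {j. e j = n}"
  unfolding proper_exponent_def by (erule allE[of _ n], erule finite_subset[rotated]) auto

lemma tendsto_theta_series:
  assumes proper: "proper_exponent e" and finite: "\<And>x. finite (S x)"
    and exhausting: "\<And>j. \<forall>\<^sub>F x in F. j \<in> S x" and tendsto: "\<And>j. ((\<lambda>x. f x j) \<longlongrightarrow> fps_const (w j)) F"
  shows "((\<lambda>x. \<Sum>j\<in>S x. fps_X ^ e j * f x j) \<longlongrightarrow> theta_series e w) F"
proof (rule tendsto_fpsI)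
  fix n
  have "\<forall>\<^sub>F x in F. \<forall>j\<in>{j. e j \<le> n}.
      j \<in> S x \<and> fps_nth (f x j) (n - e j) = fps_nth (fps_const (w j)) (n - e j)"
  proof (intro eventually_ball_finite ballI eventually_conj exhausting)
    show "finite {j. e j \<le> n}" using proper by (simp add: proper_exponent_def)
    show "\<forall>\<^sub>F x in F. fps_nth (f x j) (n - e j) = fps_nth (fps_const (w j)) (n - e j)" for j
      using tendsto[of j] unfolding tendsto_fps_iff by blast
  qed
  then show "\<forall>\<^sub>F x in F. fps_nth (\<Sum>j\<in>S x. fps_X ^ e j * f x j) n = fps_nth (theta_series e w) n"
  proof eventually_elim
    case (elim x)
    have "fps_nth (\<Sum>j\<in>S x. fps_X ^ e j * f x j) n
        = (\<Sum>j\<in>S x. if n < e j then 0 else fps_nth (f x j) (n - e j))"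
      by (simp add: fps_sum_nth fps_X_power_mult_nth)
    also have "\<dots> = (\<Sum>j\<in>{j. e j = n}. w j)"
      using elim finite by (intro sum.mono_neutral_cong_right) (auto simp: not_less)
    finally show ?case by (simp add: theta_series_nth)
  qed
qed

lemma theta_series_add: "theta_series e v + theta_series e w = theta_series e (\<lambda>j. v j + w j)"
  by (rule fps_ext) (simp add: theta_series_nth sum.distrib)

lemma theta_series_diff: "theta_series e v - theta_series e w = theta_series e (\<lambda>j. v j - w j)"
  by (rule fps_ext) (simp add: theta_series_nth sum_subtractf)

lemma fps_const_mult_theta_series: "fps_const c * theta_series e w = theta_series e (\<lambda>j. c * w j)"
  by (rule fps_ext) (simp add: theta_series_nth sum_distrib_left)

lemma fps_X_power_mult_theta_series: "fps_X ^ k * theta_series e w = theta_series (\<lambda>j. k + e j) w"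
proof (rule fps_ext)
  fix n
  have "{j. k + e j = n} = (if n < k then {} else {j. e j = n - k})" by auto
  then show "fps_nth (fps_X ^ k * theta_series e w) n = fps_nth (theta_series (\<lambda>j. k + e j) w) n"
    by (simp add: fps_X_power_mult_nth theta_series_nth)
qed

lemma fps_XD_theta_series: "fps_XD (theta_series e w) = theta_series e (\<lambda>j. of_nat (e j) * w j)"
  by (rule fps_ext) (simp add: theta_series_nth sum_distrib_left)

lemma theta_series_compose_neg_X:
  "theta_series e w oo - fps_X = theta_series e (\<lambda>j. (- 1) ^ e j * w j)"
  by (rule fps_ext) (simp add: theta_series_nth sum_distrib_left fps_compose_uminus')

lemma theta_series_mult:
  assumes "proper_exponent e" "proper_exponent e'"
  shows "theta_series e v * theta_series e' w
       = theta_series (\<lambda>(i, j). e i + e' j) (\<lambda>(i, j). v i * w j)"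
proof (rule fps_ext)
  fix n
  have "fps_nth (theta_series e v * theta_series e' w) n
      = (\<Sum>k\<le>n. \<Sum>(i, j)\<in>{i. e i = k} \<times> {j. e' j = n - k}. v i * w j)"
    by (simp add: fps_mult_nth theta_series_nth sum_product sum.cartesian_product atMost_atLeast0)
  also have "\<dots> = (\<Sum>(i, j)\<in>(\<Union>k\<le>n. {i. e i = k} \<times> {j. e' j = n - k}). v i * w j)"
    using assms by (intro sum.UNION_disjoint[symmetric]) (auto simp: proper_exponent_finite_fibre)
  also have "(\<Union>k\<le>n. {i. e i = k} \<times> {j. e' j = n - k}) = {x. (case x of (i, j) \<Rightarrow> e i + e' j) = n}"
    by auto
  finally show "fps_nth (theta_series e v * theta_series e' w) n
      = fps_nth (theta_series (\<lambda>(i, j). e i + e' j) (\<lambda>(i, j). v i * w j)) n"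
    by (simp add: theta_series_nth)
qed

lemma proper_exponent_add:
  assumes "proper_exponent e" "proper_exponent e'"
  shows "proper_exponent (\<lambda>(i, j). e i + e' j)"
  unfolding proper_exponent_def
proof
  fix n
  have "finite ({i. e i \<le> n} \<times> {j. e' j \<le> n})"
    using assms by (simp add: proper_exponent_def)
  then show "finite {x. (case x of (i, j) \<Rightarrow> e i + e' j) \<le> n}"
    by (rule finite_subset[rotated]) auto
qed

lemma theta_series_reindex:
  assumes "proper_exponent e" "inj h" "\<And>x. x \<notin> range h \<Longrightarrow> w x = 0"
  shows "theta_series e w = theta_series (e \<circ> h) (w \<circ> h)"
proof (rule fps_ext)
  fix n
  have "(\<Sum>x | e x = n. w x) = (\<Sum>x\<in>h ` {y. e (h y) = n}. w x)"
  proof (intro sum.mono_neutral_right proper_exponent_finite_fibre assms(1) ballI)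
    show "w x = 0" if "x \<in> {x. e x = n} - h ` {y. e (h y) = n}" for x
      using that by (intro assms(3)) auto
  qed auto
  also have "\<dots> = (\<Sum>y | e (h y) = n. w (h y))"
    using assms(2) by (subst sum.reindex) (auto intro: inj_on_subset)
  finally show "fps_nth (theta_series e w) n = fps_nth (theta_series (e \<circ> h) (w \<circ> h)) n"
    by (simp add: theta_series_nth)
qed

definition theta_exponent :: "nat \<Rightarrow> nat \<Rightarrow> int \<Rightarrow> nat" where
  "theta_exponent r s j = r * triangle j + s * triangle (j - 1)"

lemma proper_theta_exponent:
  assumes "r + s > 0"
  shows "proper_exponent (theta_exponent r s)"
  unfolding proper_exponent_def
proof
  fix n
  have "\<bar>j\<bar> \<le> int n + 2" if "theta_exponent r s j \<le> n" for j
  proof -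
    have "triangle j \<le> theta_exponent r s j \<or> triangle (j - 1) \<le> theta_exponent r s j"
      using assms by (cases r; cases s) (auto simp: theta_exponent_def)
    then show ?thesis
      using that abs_le_triangle[of j] abs_le_triangle[of "j - 1"] by linarith
  qed
  then have "{j. theta_exponent r s j \<le> n} \<subseteq> {- int n - 2..int n + 2}"
    by (force simp: abs_le_iff)
  then show "finite {j. theta_exponent r s j \<le> n}"
    by (rule finite_subset) simp
qed

definition parity_sign :: "int \<Rightarrow> 'a::comm_ring_1" where
  "parity_sign j = (if even j then 1 else - 1)"

lemma fps_const_parity_sign: "fps_const (parity_sign j) = parity_sign j"
  by (simp add: parity_sign_def fps_const_neg[symmetric] del: fps_const_neg)

lemma minus_one_power_triangles: "(- 1) ^ (triangle j + triangle (j - 1)) = parity_sign j"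
proof -
  have "even (triangle j + triangle (j - 1)) \<longleftrightarrow> even j"
    using int_triangle_plus_triangle[of j] by (metis even_of_nat even_power pos2)
  then show ?thesis by (simp add: minus_one_power_iff parity_sign_def)
qed

lemma theta_term_neg_X_power:
  "theta_term (- (fps_X ^ r)) (- (fps_X ^ s)) j = fps_X ^ theta_exponent r s j * parity_sign j"
  unfolding theta_term_def theta_exponent_def minus_one_power_triangles[symmetric]
  by (subst (1 2) power_minus) (simp add: power_add power_mult mult_ac)

lemma eventually_in_symmetric_interval:
  assumes "filterlim m at_top F" "filterlim n at_top F"
  shows "\<forall>\<^sub>F x in F. j \<in> {- int (n x)..int (m x)}"
proof -
  have "\<forall>\<^sub>F x in F. nat \<bar>j\<bar> \<le> m x" "\<forall>\<^sub>F x in F. nat \<bar>j\<bar> \<le> n x"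
    using assms by (simp_all add: filterlim_at_top)
  then show ?thesis by eventually_elim auto
qed

lemma qbin_centred_tendsto_inverse_eta_prod:
  assumes "d > 0" "filterlim m at_top F" "filterlim n at_top F"
  shows "((\<lambda>x. qbin (fps_X ^ d) (m x + n x) (nat (int (m x) - j))) \<longlongrightarrow> inverse (eta_prod d)) F"
proof (rule Lim_transform_eventually)
  let ?a = "\<lambda>x. nat (int (m x) + - j)" and ?b = "\<lambda>x. nat (int (n x) + j)"
  show "((\<lambda>x. qbin (fps_X ^ d) (?a x + ?b x) (?a x)) \<longlongrightarrow> inverse (eta_prod d)) F"
    using assms by (intro qbin_tendsto_inverse_eta_prod filterlim_nat_int_add)
  show "\<forall>\<^sub>F x in F. qbin (fps_X ^ d) (?a x + ?b x) (?a x)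
      = (qbin (fps_X ^ d) (m x + n x) (nat (int (m x) - j)) :: rat fps)"
    using eventually_in_symmetric_interval[OF assms(2,3), of j]
    by eventually_elim (simp add: nat_add_distrib[symmetric] nat_int_add)
qed

theorem jacobi_triple_product_tendsto:
  fixes w :: "int \<Rightarrow> rat"
  assumes d: "d = r + s" "d > 0"
    and lim: "filterlim k at_top F" "filterlim m at_top F" "filterlim n at_top F"
  shows "((\<lambda>x. qfac (fps_X ^ d) (k x)
        * jtp_sum (- (fps_X ^ r)) (- (fps_X ^ s)) (\<lambda>j. fps_const (w j)) (m x) (n x))
      \<longlongrightarrow> theta_series (theta_exponent r s) (\<lambda>j. parity_sign j * w j)) F"
proof -
  let ?q = "fps_X ^ d :: rat fps" and ?S = "\<lambda>x. {- int (n x)..int (m x)}"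
  let ?c = "\<lambda>x j. fps_const (parity_sign j * w j)
      * (qfac ?q (k x) * qbin ?q (m x + n x) (nat (int (m x) - j)))"
  have "((\<lambda>x. ?c x j) \<longlongrightarrow> fps_const (parity_sign j * w j) * (eta_prod d * inverse (eta_prod d))) F" for j
    by (intro tendsto_mult tendsto_const qfac_tendsto_eta_prod qbin_centred_tendsto_inverse_eta_prod d lim)
  then have "((\<lambda>x. ?c x j) \<longlongrightarrow> fps_const (parity_sign j * w j)) F" for j
    by simp
  then have "((\<lambda>x. \<Sum>j\<in>?S x. fps_X ^ theta_exponent r s j * ?c x j)
      \<longlongrightarrow> theta_series (theta_exponent r s) (\<lambda>j. parity_sign j * w j)) F"
    using d lim
    by (intro tendsto_theta_series proper_theta_exponent eventually_in_symmetric_interval) auto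
  moreover have "qfac ?q (k x) * jtp_sum (- (fps_X ^ r)) (- (fps_X ^ s)) (\<lambda>j. fps_const (w j)) (m x) (n x)
      = (\<Sum>j\<in>?S x. fps_X ^ theta_exponent r s j * ?c x j)" for x
    unfolding jtp_sum_def theta_term_neg_X_power sum_distrib_left
    by (intro sum.cong refl)
      (simp add: d(1) power_add fps_const_parity_sign mult_ac flip: fps_const_mult)
  ultimately show ?thesis by simp
qed

theorem euler_pentagonal: "eta_prod 1 = theta_series (theta_exponent 1 2) parity_sign"
proof (rule LIMSEQ_unique)
  have "- (fps_X ^ 1) * - (fps_X ^ 2) = (fps_X ^ 3 :: rat fps)"
    by (simp add: power3_eq_cube power2_eq_square)
  then have "qfac (fps_X ^ 3) n * jtp_sum (- (fps_X ^ 1)) (- (fps_X ^ 2)) (\<lambda>j. fps_const (1 :: rat)) n n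
      = qfac (fps_X ^ 1) (3 * n)" for n
    unfolding fps_const_1_eq_1 finite_jacobi_triple_product by (simp add: qfac_triple)
  then show "(\<lambda>n. qfac (fps_X ^ 1 :: rat fps) (3 * n)) \<longlonglongrightarrow> theta_series (theta_exponent 1 2) parity_sign"
    using jacobi_triple_product_tendsto[of 3 1 2 "\<lambda>n. n" sequentially "\<lambda>n. n" "\<lambda>n. n" "\<lambda>_. 1"]
    by (simp add: filterlim_ident)
  show "(\<lambda>n. qfac (fps_X ^ 1 :: rat fps) (3 * n)) \<longlonglongrightarrow> eta_prod 1"
    by (intro qfac_tendsto_eta_prod mult_nat_left_at_top) simp_all
qed

definition ramanujan_phi :: "rat fps" where
  "ramanujan_phi = theta_series (theta_exponent 1 1) (\<lambda>_. 1)"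

lemma ramanujan_phi_compose_neg_X:
  "ramanujan_phi oo - fps_X = theta_series (theta_exponent 1 1) parity_sign"
proof -
  have "(- 1) ^ theta_exponent 1 1 j = (parity_sign j :: rat)" for j
    using minus_one_power_triangles[of j] by (simp add: theta_exponent_def)
  then show ?thesis by (simp add: ramanujan_phi_def theta_series_compose_neg_X)
qed

theorem gauss_square: "eta_prod 1 ^ 2 = eta_prod 2 * (ramanujan_phi oo - fps_X)"
  unfolding ramanujan_phi_compose_neg_X
proof (rule LIMSEQ_unique)
  let ?J = "\<lambda>n. jtp_sum (- (fps_X ^ 1)) (- (fps_X ^ 1)) (\<lambda>j. fps_const 1) n n :: rat fps"
  have "- (fps_X ^ 1) * - (fps_X ^ 1) = (fps_X ^ 2 :: rat fps)"
    by (simp add: power2_eq_square)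
  then have "qfac (fps_X ^ 2) n * (qfac (fps_X ^ 2) n * ?J n) = qfac (fps_X ^ 1) (2 * n) ^ 2" for n
    unfolding fps_const_1_eq_1 finite_jacobi_triple_product qfac_double
    by (simp add: power2_eq_square[of "_ * _"] mult_ac)
  moreover have "(\<lambda>n. qfac (fps_X ^ 2) n * (qfac (fps_X ^ 2) n * ?J n))
      \<longlonglongrightarrow> eta_prod 2 * theta_series (theta_exponent 1 1) parity_sign"
    using jacobi_triple_product_tendsto[of 2 1 1 "\<lambda>n. n" sequentially "\<lambda>n. n" "\<lambda>n. n" "\<lambda>_. 1"]
    by (intro tendsto_mult qfac_tendsto_eta_prod) (simp_all add: filterlim_ident)
  ultimately show "(\<lambda>n. qfac (fps_X ^ 1 :: rat fps) (2 * n) ^ 2)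
      \<longlonglongrightarrow> eta_prod 2 * theta_series (theta_exponent 1 1) parity_sign" by simp
  show "(\<lambda>n. qfac (fps_X ^ 1 :: rat fps) (2 * n) ^ 2) \<longlonglongrightarrow> eta_prod 1 ^ 2"
    by (intro tendsto_intros qfac_tendsto_eta_prod mult_nat_left_at_top) simp_all
qed

lemma gauss_square_neg: "(eta_prod 1 oo - fps_X) ^ 2 = eta_prod 2 * ramanujan_phi"
proof -
  have "(ramanujan_phi oo - fps_X) oo - fps_X = ramanujan_phi"
    by (rule fps_ext) (simp add: fps_compose_uminus')
  moreover have "(eta_prod 1 oo - fps_X) ^ 2 = eta_prod 1 ^ 2 oo - fps_X"
    by (rule fps_compose_power) simp
  ultimately show ?thesis
    unfolding gauss_square by (simp add: fps_compose_mult_distrib eta_prod_compose_neg_X)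
qed

theorem jacobi_cube:
  assumes "d > 0"
  shows "2 * eta_prod d ^ 3 = theta_series (theta_exponent 0 d) (\<lambda>j. parity_sign j * of_int (1 - 2 * j))"
proof (rule LIMSEQ_unique)
  let ?qfac = "qfac (fps_X ^ d) :: nat \<Rightarrow> rat fps"
  let ?J = "\<lambda>n. jtp_sum (- (fps_X ^ 0)) (- (fps_X ^ d)) (\<lambda>j. fps_const (of_int (1 - 2 * j))) (Suc n) n"
  have "?qfac n * ?J n = 2 * ?qfac n ^ 3" for n
    unfolding fps_of_int power_0 finite_jacobi_cube by (simp add: power3_eq_cube)
  moreover have "(\<lambda>n. ?qfac n * ?J n)
      \<longlonglongrightarrow> theta_series (theta_exponent 0 d) (\<lambda>j. parity_sign j * of_int (1 - 2 * j))"
    using jacobi_triple_product_tendsto[of d 0 d "\<lambda>n. n" sequentially Suc "\<lambda>n. n" "\<lambda>j. of_int (1 - 2 * j)"] assms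
    by (simp add: filterlim_ident filterlim_Suc)
  ultimately show "(\<lambda>n. 2 * ?qfac n ^ 3)
      \<longlonglongrightarrow> theta_series (theta_exponent 0 d) (\<lambda>j. parity_sign j * of_int (1 - 2 * j))" by simp
  show "(\<lambda>n. 2 * ?qfac n ^ 3) \<longlonglongrightarrow> 2 * eta_prod d ^ 3"
    using assms by (intro tendsto_intros qfac_tendsto_eta_prod filterlim_ident)
qed

section \<open>The Wronskian of \<open>f\<^sub>1(q)\<close> and \<open>f\<^sub>1(-q)\<close>\<close>

definition fps_wronskian :: "'a::comm_ring_1 fps \<Rightarrow> 'a fps \<Rightarrow> 'a fps" where
  "fps_wronskian f g = f * fps_XD g - g * fps_XD f"

lemma fps_wronskian_mult_left: "fps_wronskian (c * f) (c * g) = c ^ 2 * fps_wronskian f g"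
  by (simp add: fps_wronskian_def fps_XD_mult power2_eq_square algebra_simps)

lemma fps_wronskian_square: "fps_wronskian (f ^ 2) (g ^ 2) = 2 * f * g * fps_wronskian f g"
  by (simp add: fps_wronskian_def fps_XD_mult power2_eq_square algebra_simps)

lemma fps_wronskian_theta_series:
  assumes "proper_exponent e"
  shows "2 * fps_wronskian (theta_series e v) (theta_series e w)
       = theta_series (\<lambda>(i, j). e i + e j)
           (\<lambda>(i, j). (v i * w j - w i * v j) * (of_nat (e j) - of_nat (e i)))"
proof -
  let ?e = "\<lambda>(i, j). e i + e j" and ?u = "\<lambda>(i, j). (v i * w j - w i * v j) * of_nat (e j)"
  have "fps_wronskian (theta_series e v) (theta_series e w) = theta_series ?e ?u"
    unfolding fps_wronskian_def fps_XD_theta_series theta_series_mult[OF assms assms] theta_series_diff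
    by (rule arg_cong[where f = "theta_series ?e"]) (auto simp: fun_eq_iff algebra_simps)
  then have "2 * fps_wronskian (theta_series e v) (theta_series e w)
      = theta_series ?e ?u + theta_series ?e ?u" by (simp only: mult_2)
  also have "\<dots> = theta_series ?e ?u + theta_series ?e (?u \<circ> prod.swap)"
  proof -
    have symmetric: "?e \<circ> prod.swap = ?e" by (simp add: fun_eq_iff add.commute)
    have "theta_series ?e ?u = theta_series (?e \<circ> prod.swap) (?u \<circ> prod.swap)"
      by (rule theta_series_reindex[OF proper_exponent_add[OF assms assms]]) auto
    then show ?thesis unfolding symmetric by (rule arg_cong)
  qed
  also have "\<dots> = theta_series ?e
      (\<lambda>(i, j). (v i * w j - w i * v j) * (of_nat (e j) - of_nat (e i)))"
    unfolding theta_series_add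
    by (rule arg_cong[where f = "theta_series ?e"]) (auto simp: fun_eq_iff algebra_simps)
  finally show ?thesis .
qed

lemma theta_exponent_1_1: "int (theta_exponent 1 1 j) = j ^ 2"
  using int_triangle_plus_triangle[of j] by (simp add: theta_exponent_def)

lemma theta_exponent_0_4: "int (theta_exponent 0 4 j) = 2 * j * (j - 1)"
  using two_times_triangle[of "j - 1"] by (simp add: theta_exponent_def algebra_simps)

lemma theta_exponent_1_2: "24 * int (theta_exponent 1 2 j) + 1 = (6 * j - 1) ^ 2"
  using two_times_triangle[of j] two_times_triangle[of "j - 1"]
  by (simp add: theta_exponent_def algebra_simps power2_eq_square)

definition lattice_rotation :: "int \<times> int \<Rightarrow> int \<times> int" where
  "lattice_rotation = (\<lambda>(i, j). (i - j, i + j - 1))"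

lemma inj_lattice_rotation: "inj lattice_rotation"
  by (auto simp: lattice_rotation_def inj_def)

lemma odd_add_in_range_lattice_rotation:
  assumes "odd (m + k)"
  shows "(m, k) \<in> range lattice_rotation"
proof -
  from assms obtain i where "m + k = 2 * i + 1" by (rule oddE)
  then have "(m, k) = lattice_rotation (i + 1, i + 1 - m)" by (simp add: lattice_rotation_def)
  then show ?thesis by blast
qed

lemma theta_exponent_lattice_rotation:
  "theta_exponent 1 1 (i - j) + theta_exponent 1 1 (i + j - 1) = 1 + (theta_exponent 0 4 i + theta_exponent 0 4 j)"
proof -
  have "int (theta_exponent 1 1 (i - j) + theta_exponent 1 1 (i + j - 1))
      = int (1 + (theta_exponent 0 4 i + theta_exponent 0 4 j))"
    unfolding of_nat_add theta_exponent_1_1 theta_exponent_0_4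
    by (simp add: algebra_simps power2_eq_square)
  then show ?thesis unfolding of_nat_eq_iff .
qed

lemma wronskian_weight_lattice_rotation:
  "(parity_sign (i - j) - parity_sign (i + j - 1))
      * (of_nat (theta_exponent 1 1 (i + j - 1)) - of_nat (theta_exponent 1 1 (i - j)))
   = (2 * ((parity_sign i * of_int (1 - 2 * i)) * (parity_sign j * of_int (1 - 2 * j))) :: 'a::comm_ring_1)"
proof -
  have square: "of_nat (theta_exponent 1 1 k) = (of_int (k ^ 2) :: 'a)" for k
    unfolding theta_exponent_1_1[symmetric] by (rule of_int_of_nat_eq[symmetric])
  have "of_nat (theta_exponent 1 1 (i + j - 1)) - of_nat (theta_exponent 1 1 (i - j))
      = (of_int ((1 - 2 * i) * (1 - 2 * j)) :: 'a)"
    unfolding square by (simp add: algebra_simps power2_eq_square)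
  moreover have "parity_sign (i - j) - parity_sign (i + j - 1) = (2 * (parity_sign i * parity_sign j) :: 'a)"
    by (auto simp: parity_sign_def)
  ultimately show ?thesis by (simp only: of_int_mult mult_ac)
qed

text \<open>Rotating the lattice by 45 degrees turns the square of Jacobi's series into the Wronskian of
  \<open>\<phi>(-q)\<close> and \<open>\<phi>(q)\<close>.\<close>
lemma wronskian_ramanujan_phi:
  "fps_wronskian (ramanujan_phi oo - fps_X) ramanujan_phi = 4 * fps_X * eta_prod 4 ^ 6" (is "?W = _")
proof -
  let ?e = "theta_exponent 1 1" and ?c = "theta_exponent 0 4"
  let ?u = "\<lambda>(m, k). (parity_sign m - parity_sign k) * (of_nat (?e k) - of_nat (?e m)) :: rat"
  let ?w = "\<lambda>j. parity_sign j * of_int (1 - 2 * j) :: rat"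
  have proper: "proper_exponent ?e" "proper_exponent ?c" by (simp_all add: proper_theta_exponent)
  have exponents: "(\<lambda>(m, k). ?e m + ?e k) \<circ> lattice_rotation = (\<lambda>(i, j). 1 + (?c i + ?c j))"
    unfolding fun_eq_iff split_paired_All comp_def lattice_rotation_def prod.case
    by (intro allI theta_exponent_lattice_rotation)
  have weights: "?u \<circ> lattice_rotation = (\<lambda>(i, j). 2 * (?w i * ?w j))"
    unfolding fun_eq_iff split_paired_All comp_def lattice_rotation_def prod.case
    by (intro allI wronskian_weight_lattice_rotation)
  have "2 * ?W = theta_series (\<lambda>(m, k). ?e m + ?e k) ?u"
    using fps_wronskian_theta_series[OF proper(1), of parity_sign "\<lambda>_. 1"]
    unfolding ramanujan_phi_compose_neg_X by (simp add: ramanujan_phi_def)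
  also have "\<dots> = theta_series ((\<lambda>(m, k). ?e m + ?e k) \<circ> lattice_rotation) (?u \<circ> lattice_rotation)"
  proof (rule theta_series_reindex[OF proper_exponent_add[OF proper(1) proper(1)] inj_lattice_rotation])
    show "?u x = 0" if "x \<notin> range lattice_rotation" for x
    proof (cases x)
      case (Pair m k)
      then have "even (m + k)" using that odd_add_in_range_lattice_rotation by blast
      then show ?thesis by (auto simp: Pair parity_sign_def)
    qed
  qed
  also have "\<dots> = fps_const 2 * (fps_X ^ 1 * (theta_series ?c ?w * theta_series ?c ?w))"
    unfolding exponents weights theta_series_mult[OF proper(2) proper(2)] fps_X_power_mult_theta_series
      fps_const_mult_theta_series by (simp add: case_prod_unfold)
  also have "\<dots> = 2 * (4 * fps_X * eta_prod 4 ^ 6)"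
    unfolding jacobi_cube[symmetric, OF zero_less_numeral]
    by (simp add: numeral_fps_const[symmetric] power_add[symmetric])
  finally show ?thesis by (simp only: mult_cancel_left) simp
qed

definition eta_quotient :: "rat fps" where
  "eta_quotient = eta_prod 2 ^ 7 * inverse (eta_prod 1)"

lemma wronskian_eta_prod:
  "fps_wronskian (eta_prod 1) (eta_prod 1 oo - fps_X) = 2 * fps_X * (eta_quotient oo fps_X ^ 2)"
proof -
  let ?f = "eta_prod 1" and ?f\<^sub>2 = "eta_prod 2" and ?f\<^sub>4 = "eta_prod 4"
  let ?g = "?f oo - fps_X"
  let ?W = "fps_wronskian ?f ?g"
  have "2 * ?f * ?g * ?W = fps_wronskian (?f ^ 2) (?g ^ 2)"
    by (rule fps_wronskian_square[symmetric])
  also have "\<dots> = ?f\<^sub>2 ^ 2 * (4 * fps_X * ?f\<^sub>4 ^ 6)"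
    unfolding gauss_square gauss_square_neg fps_wronskian_mult_left wronskian_ramanujan_phi ..
  finally have "2 * (?f * ?g * ?f\<^sub>4) * ?W = 4 * fps_X * ?f\<^sub>2 ^ 2 * (?f\<^sub>4 ^ 6 * ?f\<^sub>4)"
    by (simp add: mult_ac)
  then have "(2 * ?f\<^sub>2 ^ 2) * (?f\<^sub>2 * ?W) = (2 * ?f\<^sub>2 ^ 2) * (2 * fps_X * ?f\<^sub>4 ^ 7)"
    unfolding eta_prod_mult_eta_prod_neg by (simp add: power_numeral_reduce algebra_simps)
  then have "?f\<^sub>2 * ?W = 2 * fps_X * ?f\<^sub>4 ^ 7 * (inverse ?f\<^sub>2 * ?f\<^sub>2)"
    by (simp only: mult_cancel_left) (simp add: inverse_mult_eq_1)
  then have "?f\<^sub>2 * ?W = ?f\<^sub>2 * (2 * fps_X * (?f\<^sub>4 ^ 7 * inverse ?f\<^sub>2))"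
    by (simp only: mult_ac)
  then have "?W = 2 * fps_X * (?f\<^sub>4 ^ 7 * inverse ?f\<^sub>2)"
    by (simp only: mult_cancel_left) simp
  moreover have "eta_quotient oo fps_X ^ 2 = ?f\<^sub>4 ^ 7 * inverse ?f\<^sub>2"
    by (simp add: eta_quotient_def fps_compose_mult_distrib fps_compose_power[symmetric] fps_inverse_compose
        eta_prod_compose_X_power)
  ultimately show ?thesis by simp
qed

lemma eta_quotient_nth:
  fixes n :: nat
  defines "e \<equiv> theta_exponent 1 2"
  shows "4 * fps_nth eta_quotient n
       = (\<Sum>(i, j) | e i + e j = 2 * n + 1.
           parity_sign i * parity_sign j * ((- 1) ^ e j - (- 1) ^ e i) * (of_nat (e j) - of_nat (e i)))"
proof -
  let ?W = "fps_wronskian (eta_prod 1) (eta_prod 1 oo - fps_X)"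
  have "fps_nth ?W (2 * n + 1) = 2 * fps_nth eta_quotient n"
    unfolding wronskian_eta_prod by (simp add: mult.assoc numeral_fps_const fps_compose_X_power_nth)
  then have "4 * fps_nth eta_quotient n = fps_nth (2 * ?W) (2 * n + 1)"
    by (simp add: numeral_fps_const)
  also have "2 * ?W = theta_series (\<lambda>(i, j). e i + e j)
      (\<lambda>(i, j). (parity_sign i * ((- 1) ^ e j * parity_sign j) - (- 1) ^ e i * parity_sign i * parity_sign j)
        * (of_nat (e j) - of_nat (e i)))"
    unfolding euler_pentagonal theta_series_compose_neg_X e_def[symmetric]
    by (rule fps_wronskian_theta_series) (simp add: e_def proper_theta_exponent)
  finally show ?thesis
    by (simp add: theta_series_nth case_prod_unfold algebra_simps)
qed

section \<open>Congruences\<close>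

lemma prime_3_mod_4_dvd_sum_squaresD:
  fixes p :: nat and x y :: int
  assumes prime: "prime p" "p mod 4 = 3" and dvd: "int p dvd x ^ 2 + y ^ 2"
  shows "int p dvd y"
proof (rule ccontr)
  assume "\<not> int p dvd y"
  let ?h = "(p - 1) div 2"
  have "p > 2" using prime(2) by (cases "p = 0 \<or> p = 1 \<or> p = 2") auto
  have "prime (int p)" using prime(1) by simp
  then have nonzero: "[y ^ 2 \<noteq> 0] (mod int p)" "[- (y ^ 2) \<noteq> 0] (mod int p)"
    using \<open>\<not> int p dvd y\<close> by (simp_all add: cong_0_iff prime_dvd_power_iff)
  have "[x ^ 2 = - (y ^ 2)] (mod int p)"
    using dvd by (simp add: cong_iff_dvd_diff)
  then have "QuadRes (int p) (y ^ 2)" "QuadRes (int p) (- (y ^ 2))"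
    unfolding QuadRes_def by (blast intro: cong_refl)+
  then have "Legendre (y ^ 2) (int p) = 1" "Legendre (- (y ^ 2)) (int p) = 1"
    using nonzero by (simp_all add: Legendre_def)
  then have "[1 = (y ^ 2) ^ ?h] (mod int p)" "[1 = (- (y ^ 2)) ^ ?h] (mod int p)"
    using euler_criterion[OF prime(1) \<open>p > 2\<close>] by metis+
  moreover have "odd ?h" using prime(2) by presburger
  ultimately have "[1 = - 1] (mod int p)"
    by (metis cong_minus_minus_iff cong_sym cong_trans power_minus_odd)
  then have "int p dvd 2" by (simp add: cong_iff_dvd_diff)
  then show False using \<open>p > 2\<close> zdvd_imp_le by fastforce
qed

lemma zero_mod_0 [simp]: "zero_mod 0 m"
  by (auto simp: zero_mod_def intro: exI[of _ 0])

lemma zero_mod_of_int: "zero_mod (of_int a) m \<longleftrightarrow> m dvd a"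
  unfolding zero_mod_def of_int_eq_iff dvd_def ..

lemma zero_mod_1_iff: "zero_mod x 1 \<longleftrightarrow> x \<in> \<int>"
  by (auto simp: zero_mod_def Ints_def)

lemma zero_mod_add: "zero_mod x m \<Longrightarrow> zero_mod y m \<Longrightarrow> zero_mod (x + y) m"
  unfolding zero_mod_def by (metis distrib_left of_int_add)

lemma zero_mod_minus: "zero_mod x m \<Longrightarrow> zero_mod (- x) m"
  unfolding zero_mod_def by (metis mult_minus_right of_int_minus)

lemma zero_mod_mult: "x \<in> \<int> \<Longrightarrow> zero_mod y m \<Longrightarrow> zero_mod (x * y) m"
  unfolding zero_mod_def by (metis Ints_cases mult.left_commute of_int_mult)

lemma zero_mod_sum: "(\<And>i. i \<in> S \<Longrightarrow> zero_mod (f i) m) \<Longrightarrow> zero_mod (sum f S) m"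
  by (induction S rule: infinite_finite_induct) (auto intro: zero_mod_add)

lemma zero_mod_cancel:
  assumes "coprime k m" "x \<in> \<int>" "zero_mod (of_int k * x) m"
  shows "zero_mod x m"
proof -
  obtain a where "x = of_int a" using assms(2) by (rule Ints_cases)
  then have "m dvd k * a" using assms(3) by (simp only: zero_mod_of_int of_int_mult[symmetric])
  then have "m dvd a"
    using assms(1) by (simp add: coprime_commute coprime_dvd_mult_right_iff)
  then show ?thesis by (simp only: zero_mod_of_int \<open>x = of_int a\<close>)
qed

definition fps_zero_mod :: "rat fps \<Rightarrow> int \<Rightarrow> bool" where
  "fps_zero_mod A m \<longleftrightarrow> (\<forall>n. zero_mod (fps_nth A n) m)"

abbreviation integral_fps :: "rat fps \<Rightarrow> bool" where
  "integral_fps A \<equiv> fps_zero_mod A 1"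

lemma fps_zero_mod_0: "fps_zero_mod 0 m"
  by (simp add: fps_zero_mod_def)

lemma fps_zero_mod_add: "fps_zero_mod A m \<Longrightarrow> fps_zero_mod B m \<Longrightarrow> fps_zero_mod (A + B) m"
  by (simp add: fps_zero_mod_def zero_mod_add)

lemma fps_zero_mod_minus: "fps_zero_mod A m \<Longrightarrow> fps_zero_mod (- A) m"
  by (simp add: fps_zero_mod_def zero_mod_minus)

lemma fps_zero_mod_diff: "fps_zero_mod A m \<Longrightarrow> fps_zero_mod B m \<Longrightarrow> fps_zero_mod (A - B) m"
  using fps_zero_mod_add[OF _ fps_zero_mod_minus] by fastforce

lemma fps_zero_mod_mult: "integral_fps A \<Longrightarrow> fps_zero_mod B m \<Longrightarrow> fps_zero_mod (A * B) m"
  unfolding fps_zero_mod_def fps_mult_nth by (auto simp: zero_mod_1_iff intro: zero_mod_sum zero_mod_mult)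

lemma fps_zero_mod_sum: "(\<And>i. i \<in> S \<Longrightarrow> fps_zero_mod (f i) m) \<Longrightarrow> fps_zero_mod (sum f S) m"
  by (simp add: fps_zero_mod_def fps_sum_nth zero_mod_sum)

lemma fps_zero_mod_of_nat: "fps_zero_mod (of_nat k) (int m) \<longleftrightarrow> m dvd k"
proof -
  have "zero_mod (of_nat k) (int m) \<longleftrightarrow> m dvd k"
    using zero_mod_of_int[of "int k" "int m"] by simp
  then show ?thesis by (auto simp: fps_zero_mod_def fps_of_nat[symmetric] simp del: fps_of_nat)
qed

lemma fps_zero_mod_lim:
  assumes "(f \<longlongrightarrow> A) F" "F \<noteq> bot" "\<And>x. fps_zero_mod (f x) m"
  shows "fps_zero_mod A m"
  unfolding fps_zero_mod_def
proof
  fix n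
  have "\<forall>\<^sub>F x in F. fps_nth (f x) n = fps_nth A n"
    using assms(1) by (simp add: tendsto_fps_iff)
  then obtain x where "fps_nth (f x) n = fps_nth A n"
    using assms(2) eventually_happens' by blast
  then show "zero_mod (fps_nth A n) m"
    using assms(3)[of x] by (metis fps_zero_mod_def)
qed

lemma integral_fps_1: "integral_fps 1"
  using fps_zero_mod_of_nat[of 1 1] by simp

lemma integral_fps_X: "integral_fps fps_X"
  by (simp add: fps_zero_mod_def fps_X_def zero_mod_1_iff)

lemma integral_fps_power: "integral_fps A \<Longrightarrow> integral_fps (A ^ n)"
  by (induction n) (simp_all add: integral_fps_1 fps_zero_mod_mult)

lemma integral_fps_prod: "(\<And>i. i \<in> S \<Longrightarrow> integral_fps (f i)) \<Longrightarrow> integral_fps (prod f S)"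
  by (induction S rule: infinite_finite_induct) (simp_all add: integral_fps_1 fps_zero_mod_mult)

lemma integral_fps_inverse:
  assumes "integral_fps A" "fps_nth A 0 = 1"
  shows "integral_fps (inverse A)"
proof -
  have "fps_nth (inverse A) n \<in> \<int>" for n
  proof (induction n rule: less_induct)
    case (less n)
    show ?case
    proof (cases "n = 0")
      case False
      have "0 = fps_nth (inverse A * A) n"
        using inverse_mult_eq_1[of A] assms(2) False by simp
      also have "\<dots> = (\<Sum>i<n. fps_nth (inverse A) i * fps_nth A (n - i)) + fps_nth (inverse A) n"
        by (simp add: fps_mult_nth atLeast0AtMost lessThan_Suc_atMost[symmetric] assms(2))
      finally have "fps_nth (inverse A) n = - (\<Sum>i<n. fps_nth (inverse A) i * fps_nth A (n - i))"
        by simp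
      also have "\<dots> \<in> \<int>"
        using less assms(1) by (auto simp: fps_zero_mod_def zero_mod_1_iff)
      finally show ?thesis .
    qed (simp add: assms(2))
  qed
  then show ?thesis by (simp add: fps_zero_mod_def zero_mod_1_iff)
qed

lemma integral_fps_qfac: "integral_fps q \<Longrightarrow> integral_fps (qfac q n)"
  unfolding qfac_def by (intro integral_fps_prod fps_zero_mod_diff integral_fps_1 integral_fps_power)

lemma integral_fps_eta_prod:
  assumes "d > 0"
  shows "integral_fps (eta_prod d)"
  by (rule fps_zero_mod_lim[OF qfac_tendsto_eta_prod[OF assms filterlim_ident] sequentially_bot])
    (intro integral_fps_qfac integral_fps_power integral_fps_X)

lemma freshmans_dream_integral_fps:
  assumes prime: "prime p" and integral: "integral_fps A" "integral_fps B"
  shows "fps_zero_mod ((A + B) ^ p - (A ^ p + B ^ p)) (int p)"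
proof -
  let ?t = "\<lambda>k. of_nat (p choose k) * A ^ k * B ^ (p - k)"
  have "p > 0" using prime by (rule prime_gt_0_nat)
  then have "{..p} = {0, p} \<union> {1..<p}" by auto
  then have "(A + B) ^ p = sum ?t ({0, p} \<union> {1..<p})" by (simp only: binomial_ring)
  also have "\<dots> = sum ?t {0, p} + sum ?t {1..<p}" by (rule sum.union_disjoint) auto
  also have "sum ?t {0, p} = A ^ p + B ^ p" using \<open>p > 0\<close> by simp
  finally have "(A + B) ^ p - (A ^ p + B ^ p) = sum ?t {1..<p}" by simp
  moreover have "fps_zero_mod (?t k) (int p)" if "k \<in> {1..<p}" for k
  proof -
    have "p dvd p choose k" using that prime by (intro dvd_choose_prime) auto
    then have "fps_zero_mod (A ^ k * B ^ (p - k) * of_nat (p choose k)) (int p)"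
      using integral by (intro fps_zero_mod_mult integral_fps_power) (simp_all add: fps_zero_mod_of_nat)
    then show ?thesis by (simp only: mult_ac)
  qed
  ultimately show ?thesis by (simp only: fps_zero_mod_sum)
qed

lemma fps_zero_mod_mult_cong:
  assumes "fps_zero_mod (A - A') m" "fps_zero_mod (B - B') m" "integral_fps A" "integral_fps B'"
  shows "fps_zero_mod (A * B - A' * B') m"
proof -
  have "A * B - A' * B' = A * (B - B') + B' * (A - A')" by (simp add: algebra_simps)
  then show ?thesis
    by (simp only:) (intro fps_zero_mod_add fps_zero_mod_mult assms)
qed

lemma qfac_power_prime:
  assumes prime: "prime p" "odd p" and integral: "integral_fps q"
  shows "fps_zero_mod (qfac q n ^ p - qfac (q ^ p) n) (int p)"
proof (induction n)
  case (Suc n)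
  have "fps_zero_mod ((1 + - (q ^ Suc n)) ^ p - (1 ^ p + (- (q ^ Suc n)) ^ p)) (int p)"
    by (intro freshmans_dream_integral_fps prime(1) fps_zero_mod_minus integral_fps_1 integral_fps_power integral)
  moreover have "(- (q ^ Suc n)) ^ p = - ((q ^ p) ^ Suc n)"
    by (simp only: power_minus_odd[OF prime(2)] power_mult[symmetric] mult.commute)
  ultimately have "fps_zero_mod ((1 - q ^ Suc n) ^ p - (1 - (q ^ p) ^ Suc n)) (int p)"
    by (simp only: power_one diff_conv_add_uminus)
  then show ?case
    unfolding qfac_Suc power_mult_distrib
    by (rule fps_zero_mod_mult_cong[OF Suc])
      (intro fps_zero_mod_diff integral_fps_1 integral_fps_power integral_fps_qfac integral)+
qed (simp add: fps_zero_mod_0)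

lemma eta_prod_power_prime:
  assumes prime: "prime p" "odd p" and "d > 0"
  shows "fps_zero_mod (eta_prod d ^ p - eta_prod (d * p)) (int p)"
proof (rule fps_zero_mod_lim)
  have "d * p > 0" using \<open>d > 0\<close> prime_gt_0_nat[OF prime(1)] by simp
  then show "(\<lambda>n. qfac (fps_X ^ d) n ^ p - qfac (fps_X ^ (d * p)) n) \<longlonglongrightarrow> eta_prod d ^ p - eta_prod (d * p)"
    using \<open>d > 0\<close> by (intro tendsto_intros qfac_tendsto_eta_prod filterlim_ident)
  show "fps_zero_mod (qfac (fps_X ^ d) n ^ p - qfac (fps_X ^ (d * p)) n) (int p)" for n
    unfolding power_mult by (intro qfac_power_prime prime integral_fps_power integral_fps_X)
qed simp

lemma inverse_eta_prod_power_cong: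
  assumes prime: "prime p" "odd p" and "d > 0" and "k \<le> p"
  shows "fps_zero_mod (inverse (eta_prod d ^ k) - eta_prod d ^ (p - k) * inverse (eta_prod (d * p))) (int p)"
proof -
  let ?f = "eta_prod d" and ?g = "eta_prod (d * p)"
  have "d * p > 0" using \<open>d > 0\<close> prime_gt_0_nat[OF prime(1)] by simp
  have unit_f: "inverse (?f ^ k) * ?f ^ k = 1" and unit_g: "inverse ?g * ?g = 1"
    by (simp_all add: inverse_mult_eq_1 fps_power_zeroth)
  have "?f ^ p = ?f ^ k * ?f ^ (p - k)"
    using \<open>k \<le> p\<close> by (simp add: power_add[symmetric])
  then have "inverse (?f ^ k) * inverse ?g * (?f ^ p - ?g)
      = (inverse (?f ^ k) * ?f ^ k) * (?f ^ (p - k) * inverse ?g) - (inverse ?g * ?g) * inverse (?f ^ k)"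
    by (simp add: algebra_simps)
  also have "\<dots> = ?f ^ (p - k) * inverse ?g - inverse (?f ^ k)"
    unfolding unit_f unit_g by simp
  finally have "inverse (?f ^ k) - ?f ^ (p - k) * inverse ?g
      = - (inverse (?f ^ k) * inverse ?g * (?f ^ p - ?g))" by simp
  moreover have "fps_zero_mod (inverse (?f ^ k) * inverse ?g * (?f ^ p - ?g)) (int p)"
    using \<open>d > 0\<close> \<open>d * p > 0\<close>
    by (intro fps_zero_mod_mult eta_prod_power_prime prime integral_fps_inverse integral_fps_power
        integral_fps_eta_prod) (simp_all add: fps_power_zeroth)
  ultimately show ?thesis by (simp only: fps_zero_mod_minus)
qed

lemma prime_coprime_24:
  fixes p :: nat
  assumes "prime p" "p > 3"
  shows "coprime (int p) 24"
proof -
  have "\<not> p dvd 2 ^ 3 * 3"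
    using assms by (auto simp: prime_dvd_mult_iff prime_dvd_power_iff simp del: power_numeral dest: dvd_imp_le)
  then have "coprime p 24" using assms(1) by (simp add: prime_imp_coprime)
  then show ?thesis using coprime_int_iff[of p 24] by simp
qed

lemma prime_dvd_theta_exponent_diff:
  fixes i j :: int
  defines "e \<equiv> theta_exponent 1 2"
  assumes prime: "prime p" "p mod 4 = 3" "p > 3" and dvd: "p dvd 24 * n + 13"
    and index_sum: "e i + e j = 2 * n + 1"
  shows "int p dvd int (e j) - int (e i)"
proof -
  have square: "24 * int (e k) + 1 = (6 * k - 1) ^ 2" for k
    unfolding e_def by (rule theta_exponent_1_2)
  have "(6 * i - 1) ^ 2 + (6 * j - 1) ^ 2 = 24 * int (e i + e j) + 2"
    unfolding square[symmetric] by simp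
  also have "\<dots> = 2 * int (24 * n + 13)" unfolding index_sum by simp
  finally have "int p dvd (6 * i - 1) ^ 2 + (6 * j - 1) ^ 2"
    using dvd by (metis dvd_mult int_dvd_int_iff)
  then have "int p dvd 6 * i - 1" "int p dvd 6 * j - 1"
    using prime_3_mod_4_dvd_sum_squaresD[OF prime(1,2)] by (metis add.commute)+
  then have "int p dvd (6 * j - 1) ^ 2 - (6 * i - 1) ^ 2"
    by (simp add: power2_eq_square)
  then have "int p dvd 24 * (int (e j) - int (e i))"
    unfolding square[symmetric] by (simp add: right_diff_distrib)
  then show ?thesis using prime_coprime_24[OF prime(1,3)] by (simp only: coprime_dvd_mult_right_iff)
qed

lemma eta_quotient_zero_mod:
  assumes prime: "prime p" "p mod 4 = 3" "p > 3" and dvd: "p dvd 24 * n + 13"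
  shows "zero_mod (fps_nth eta_quotient n) (int p)"
proof (rule zero_mod_cancel)
  let ?e = "theta_exponent 1 2"
  have "zero_mod (parity_sign i * parity_sign j * ((- 1) ^ ?e j - (- 1) ^ ?e i)
      * (of_nat (?e j) - of_nat (?e i))) (int p)" if "?e i + ?e j = 2 * n + 1" for i j
  proof (rule zero_mod_mult)
    show "parity_sign i * parity_sign j * ((- 1) ^ ?e j - (- 1) ^ ?e i) \<in> \<int>"
      by (simp add: parity_sign_def)
    have "zero_mod (of_int (int (?e j) - int (?e i))) (int p)"
      unfolding zero_mod_of_int by (rule prime_dvd_theta_exponent_diff[OF prime dvd that])
    then show "zero_mod (of_nat (?e j) - of_nat (?e i)) (int p)" by simp
  qed
  then show "zero_mod (of_int 4 * fps_nth eta_quotient n) (int p)"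
    unfolding of_int_numeral eta_quotient_nth by (intro zero_mod_sum) auto
  have "integral_fps eta_quotient"
    unfolding eta_quotient_def
    by (intro fps_zero_mod_mult integral_fps_power integral_fps_inverse integral_fps_eta_prod) simp_all
  then show "fps_nth eta_quotient n \<in> \<int>" by (simp add: fps_zero_mod_def zero_mod_1_iff)
  show "coprime 4 (int p)"
    by (rule coprime_divisors[OF _ _ coprime_commute[THEN iffD1, OF prime_coprime_24[OF prime(1,3)]]]) simp_all
qed

lemma fps_mult_nth_zero_mod:
  assumes "integral_fps A" "\<And>i. \<not> p dvd i \<Longrightarrow> fps_nth A i = 0"
    and "\<And>i. i \<le> n \<Longrightarrow> [i = n] (mod p) \<Longrightarrow> zero_mod (fps_nth B i) m"
  shows "zero_mod (fps_nth (A * B) n) m"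
  unfolding fps_mult_nth
proof (rule zero_mod_sum)
  fix i assume "i \<in> {0..n}"
  show "zero_mod (fps_nth A i * fps_nth B (n - i)) m"
  proof (cases "p dvd i")
    case True
    then have "[n - i = n] (mod p)"
      using \<open>i \<in> {0..n}\<close> by (simp add: cong_altdef_nat cong_sym_eq)
    then have "zero_mod (fps_nth B (n - i)) m" by (intro assms(3)) simp_all
    then show ?thesis using assms(1) by (intro zero_mod_mult) (simp_all add: fps_zero_mod_def zero_mod_1_iff)
  qed (simp add: assms(2))
qed

theorem a_gen_zero_mod:
  assumes prime: "prime p" "p mod 4 = 3" "p > 7" and dvd: "p dvd 24 * n + 13"
  shows "zero_mod (a_gen (p - 6) n) (int p)"
proof -
  let ?f = "eta_prod 1" and ?g = "eta_prod (2 * p)"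
  let ?A = "inverse (?f * eta_prod 2 ^ (p - 7))"
  have "fps_zero_mod (inverse ?f * (inverse (eta_prod 2 ^ (p - 7)) - eta_prod 2 ^ 7 * inverse ?g)) (int p)"
  proof (rule fps_zero_mod_mult)
    show "integral_fps (inverse ?f)" by (simp add: integral_fps_inverse integral_fps_eta_prod)
    have "odd p" using prime(2) by presburger
    then show "fps_zero_mod (inverse (eta_prod 2 ^ (p - 7)) - eta_prod 2 ^ 7 * inverse ?g) (int p)"
      using inverse_eta_prod_power_cong[of p 2 "p - 7"] prime by simp
  qed
  then have "fps_zero_mod (?A - inverse ?g * eta_quotient) (int p)"
    by (simp add: eta_quotient_def fps_inverse_mult algebra_simps)
  moreover have "zero_mod (fps_nth (inverse ?g * eta_quotient) n) (int p)"
  proof (rule fps_mult_nth_zero_mod)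
    show "integral_fps (inverse ?g)"
      using prime(3) by (intro integral_fps_inverse integral_fps_eta_prod) simp_all
    have "inverse ?g = inverse (eta_prod 2) oo fps_X ^ p"
      using prime(3) by (simp add: fps_inverse_compose eta_prod_compose_X_power mult.commute)
    then show "fps_nth (inverse ?g) i = 0" if "\<not> p dvd i" for i
      using prime(3) that by (simp add: fps_compose_X_power_nth)
    show "zero_mod (fps_nth eta_quotient i) (int p)" if "[i = n] (mod p)" for i
    proof (rule eta_quotient_zero_mod)
      have "[24 * i + 13 = 24 * n + 13] (mod p)" by (intro cong_add cong_mult that cong_refl)
      then show "p dvd 24 * i + 13" using dvd by (simp add: cong_dvd_iff)
    qed (use prime in simp_all)
  qed
  ultimately have "zero_mod (fps_nth (?A - inverse ?g * eta_quotient) n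
      + fps_nth (inverse ?g * eta_quotient) n) (int p)"
    by (intro zero_mod_add) (simp_all only: fps_zero_mod_def)
  then show ?thesis by (simp add: a_gen_def)
qed

theorem theorem1p1:
  fixes n :: nat
  shows "zero_mod (a_gen 37 (43 * n + 12)) 43 \<and>
         zero_mod (a_gen 41 (47 * n + 21)) 47 \<and>
         zero_mod (a_gen 53 (59 * n + 56)) 59 \<and>
         zero_mod (a_gen 61 (67 * n + 19)) 67 \<and>
         zero_mod (a_gen 65 (71 * n + 32)) 71 \<and>
         zero_mod (a_gen 73 (79 * n + 62)) 79 \<and>
         zero_mod (a_gen 77 (83 * n + 79)) 83"
proof -
  have "zero_mod (a_gen (p - 6) (p * n + r)) (int p)"
    if "prime p" "p mod 4 = 3" "p > 7" "p dvd 24 * r + 13" for p r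
  proof (rule a_gen_zero_mod)
    have "24 * (p * n + r) + 13 = p * (24 * n) + (24 * r + 13)" by simp
    then show "p dvd 24 * (p * n + r) + 13" using that(4) by (simp only: dvd_add dvd_triv_left)
  qed (use that in simp_all)
  from this[of 43 12] this[of 47 21] this[of 59 56] this[of 67 19] this[of 71 32] this[of 79 62]
    this[of 83 79] show ?thesis by simp
qed

end
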